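(* Let $p$ be a prime and $w\ge1$ an integer. Then the number of Scopes families is $\frac1p\binom{pw}{p-1}$.
   Context: Let $\mathscr C_p=\{(c_0,\ldots,c_{p-1})\in\mathbb Z^p:\sum c_j=0\}$. For $1\le j\le p-1$, $c\in\mathscr C_p$ is $j$-allowed if $c_j-c_{j-1}\ge w$, and then $\mathrm{sc}_j(c)$ is $c$ with coordinates $c_{j-1}$ and $c_j$ interchanged. $c$ is $0$-allowed if $c_0-c_{p-1}>w$, and then $\mathrm{sc}_0(c)=(c_{p-1}+1,c_1,\ldots,c_{p-2},c_0-1)$. The Scopes families (for $p$ and $w$) are the equivalence classes of the equivalence relation on $\mathscr C_p$ generated by $c\sim\mathrm{sc}_j(c)$ for all $0\le j\le p-1$ and all $j$-allowed $c$. (Here $\mathscr C_p$ parametrizes $p$-core partitions, and Scopes families correspond to classes of $p$-blocks of symmetric groups of weight $w$.) *)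

theory Defs
  imports Complex_Main "HOL-Computational_Algebra.Primes"
begin

definition cvecs :: "nat \<Rightarrow> int list set" where
  "cvecs p = {c. length c = p \<and> sum_list c = 0}"

definition allowed :: "nat \<Rightarrow> nat \<Rightarrow> nat \<Rightarrow> int list \<Rightarrow> bool" where
  "allowed p w j c \<longleftrightarrow>
     (if j = 0 then c ! 0 - c ! (p - 1) > int w else c ! j - c ! (j - 1) \<ge> int w)"

definition sc :: "nat \<Rightarrow> nat \<Rightarrow> int list \<Rightarrow> int list" where
  "sc p j c =
     (if j = 0 then c[0 := c ! (p - 1) + 1, p - 1 := c ! 0 - 1]
      else c[j - 1 := c ! j, j := c ! (j - 1)])"

definition scopes_step :: "nat \<Rightarrow> nat \<Rightarrow> int list \<Rightarrow> int list \<Rightarrow> bool" where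
  "scopes_step p w c d \<longleftrightarrow> c \<in> cvecs p \<and> (\<exists>j<p. allowed p w j c \<and> d = sc p j c)"

definition scopes_equiv :: "nat \<Rightarrow> nat \<Rightarrow> (int list \<times> int list) set" where
  "scopes_equiv p w =
     {(c, d). c \<in> cvecs p \<and> d \<in> cvecs p \<and> equivclp (scopes_step p w) c d}"

definition scopes_families :: "nat \<Rightarrow> nat \<Rightarrow> int list set set" where
  "scopes_families p w = cvecs p // scopes_equiv p w"

lemma equiv_scopes_equiv: "equiv (cvecs p) (scopes_equiv p w)"
  unfolding scopes_equiv_def
  by (rule equivI)
    (auto simp: refl_on_def sym_def trans_def intro: equivclp_sym equivclp_trans)

lemma sum_list_update_int:
  "k < length xs \<Longrightarrow> sum_list (xs[k := x]) = sum_list xs + x - xs ! k" for x :: int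
  by (induction xs arbitrary: k) (auto split: nat.split)

lemma sc_in_cvecs:
  assumes "c \<in> cvecs p" "2 \<le> p" "j < p"
  shows "sc p j c \<in> cvecs p"
  using assms
  by (cases "j = 0") (auto simp: cvecs_def sc_def sum_list_update_int nth_list_update)

end

theory Submission imports Defs "HOL-Library.Confluence" begin

text \<open>
  Orient every relation \<open>c \<sim> sc\<^sub>j(c)\<close> as a rewrite step \<open>c \<rightarrow> sc\<^sub>j(c)\<close>. The steps terminate,
  since they decrease \<open>\<Sum>\<^sub>i (p c\<^sub>i + i)\<^sup>2\<close>, and they are locally confluent: steps at non-adjacent
  indices commute, and steps at adjacent indices satisfy the braid relation. By Newman's lemma
  every Scopes family contains exactly one irreducible vector. Dropping the condition
  \<open>\<Sum> c\<^sub>i = 0\<close>, the slacks in the inequalities defining irreducibility are arbitrary natural numbers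
  \<open>e\<^sub>0, \<dots>, e\<^sub>p\<^sub>-\<^sub>1\<close> with sum \<open>p(w - 1) + 1\<close>; they determine \<open>c\<close> up to adding a constant vector, so
  there are \<open>pw choose (p - 1)\<close> irreducible vectors with \<open>0 \<le> \<Sum> c\<^sub>i < p\<close>. The cyclic shift
  \<open>c \<mapsto> (c\<^sub>p\<^sub>-\<^sub>1 + 1, c\<^sub>0, \<dots>, c\<^sub>p\<^sub>-\<^sub>2)\<close> preserves irreducibility and raises the sum by one, so the \<open>p\<close>
  values of the sum are equally frequent.
\<close>

section \<open>Normal forms of terminating confluent relations\<close>

definition locally_confluentp :: "('a \<Rightarrow> 'a \<Rightarrow> bool) \<Rightarrow> bool" where
  "locally_confluentp r \<longleftrightarrow> (\<forall>x y z. r x y \<longrightarrow> r x z \<longrightarrow> (\<exists>u. r\<^sup>*\<^sup>* y u \<and> r\<^sup>*\<^sup>* z u))"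

definition normal_form :: "('a \<Rightarrow> 'a \<Rightarrow> bool) \<Rightarrow> 'a \<Rightarrow> bool" where
  "normal_form r x \<longleftrightarrow> (\<nexists>y. r x y)"

lemma rtranclp_normal_form: "r\<^sup>*\<^sup>* x y \<Longrightarrow> normal_form r x \<Longrightarrow> y = x"
  unfolding normal_form_def by (metis converse_rtranclpE)

lemma ex_normal_form:
  assumes "wfp r\<inverse>\<inverse>"
  shows "\<exists>n. r\<^sup>*\<^sup>* x n \<and> normal_form r n"
  using assms
proof (induction x rule: wfp_induct_rule)
  case (less x)
  show ?case
  proof (cases "normal_form r x")
    case False
    then obtain y where "r x y" by (auto simp: normal_form_def)
    then show ?thesis using less.IH[of y] by (auto intro: converse_rtranclp_into_rtranclp)
  qed blast
qed

theorem newman: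
  assumes wf: "wfp r\<inverse>\<inverse>" and local: "locally_confluentp r"
  shows "confluentp r"
proof (rule confluentpI)
  fix x y z
  assume "r\<^sup>*\<^sup>* x y" "r\<^sup>*\<^sup>* x z"
  with wf show "\<exists>u. r\<^sup>*\<^sup>* y u \<and> r\<^sup>*\<^sup>* z u"
  proof (induction x arbitrary: y z rule: wfp_induct_rule)
    case (less x)
    show ?case
    proof (cases "x = y \<or> x = z")
      case False
      then obtain y' z' where to_y: "r x y'" "r\<^sup>*\<^sup>* y' y" and to_z: "r x z'" "r\<^sup>*\<^sup>* z' z"
        using less.prems by (metis converse_rtranclpE)
      obtain u where y'z'_join: "r\<^sup>*\<^sup>* y' u" "r\<^sup>*\<^sup>* z' u"
        using local to_y(1) to_z(1) unfolding locally_confluentp_def by blast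
      obtain v where yu_join: "r\<^sup>*\<^sup>* y v" "r\<^sup>*\<^sup>* u v"
        using less.IH[of y'] to_y y'z'_join(1) by auto
      have "r\<^sup>*\<^sup>* z' v" using y'z'_join(2) yu_join(2) by (rule rtranclp_trans)
      then obtain t where "r\<^sup>*\<^sup>* v t" "r\<^sup>*\<^sup>* z t"
        using less.IH[of z'] to_z by auto
      then show ?thesis using yu_join(1) by (meson rtranclp_trans)
    qed (use less.prems in blast)
  qed
qed

lemma confluentp_normal_form_unique:
  assumes "confluentp r" "equivclp r x y" "normal_form r x" "normal_form r y"
  shows "x = y"
proof -
  obtain u where "r\<^sup>*\<^sup>* x u" "r\<^sup>*\<^sup>* y u"
    using assms(1,2) semiconfluentp_equivclp[of r]
    by (auto simp: confluentp_eq_semiconfluentp rtranclp_conversep)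
  then show ?thesis using assms(3,4) rtranclp_normal_form by metis
qed

lemma bij_betw_normal_forms_quotient:
  assumes wf: "wfp r\<inverse>\<inverse>" and conf: "confluentp r"
    and closed: "\<And>x y. x \<in> A \<Longrightarrow> r x y \<Longrightarrow> y \<in> A"
    and equiv: "equiv A E"
    and mem_E_iff: "\<And>x y. (x, y) \<in> E \<longleftrightarrow> x \<in> A \<and> y \<in> A \<and> equivclp r x y"
  shows "bij_betw (\<lambda>x. E `` {x}) {x \<in> A. normal_form r x} (A // E)"
proof (rule bij_betwI')
  fix x y
  assume "x \<in> {x \<in> A. normal_form r x}" "y \<in> {x \<in> A. normal_form r x}"
  then show "E `` {x} = E `` {y} \<longleftrightarrow> x = y"
    using confluentp_normal_form_unique[OF conf] by (auto simp: eq_equiv_class_iff[OF equiv] mem_E_iff)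
next
  fix C
  assume "C \<in> A // E"
  then obtain x where x_class: "x \<in> A" "C = E `` {x}" by (rule quotientE)
  obtain n where nf: "r\<^sup>*\<^sup>* x n" "normal_form r n" using ex_normal_form[OF wf] by blast
  have "n \<in> A" using nf(1) x_class(1) by (induction rule: rtranclp_induct) (auto intro: closed)
  moreover have "equivclp r x n" using nf(1) by (rule rtranclp_into_equivclp)
  ultimately have "C = E `` {n}" using x_class equiv_class_eq[OF equiv] mem_E_iff by blast
  then show "\<exists>n\<in>{x \<in> A. normal_form r x}. C = E `` {n}" using \<open>n \<in> A\<close> nf(2) by blast
qed (auto intro: quotientI)

section \<open>Ascents\<close>

definition cyclic_pred :: "nat \<Rightarrow> nat \<Rightarrow> nat" where
  "cyclic_pred p j = (if j = 0 then p - 1 else j - 1)"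

definition wrap :: "nat \<Rightarrow> int" where
  "wrap j = (if j = 0 then 1 else 0)"

text \<open>Once \<open>c\<close> is extended to all of \<open>\<int>\<close> by \<open>c\<^sub>j\<^sub>-\<^sub>p = c\<^sub>j + 1\<close>, the \<open>j\<close>-th ascent is \<open>c\<^sub>j - c\<^sub>j\<^sub>-\<^sub>1\<close> and
  \<open>sc\<^sub>j\<close> exchanges \<open>c\<^sub>j\<^sub>-\<^sub>1\<close> and \<open>c\<^sub>j\<close>, also for \<open>j = 0\<close>.\<close>

definition ascent :: "nat \<Rightarrow> int list \<Rightarrow> nat \<Rightarrow> int" where
  "ascent p c j = c ! j - c ! cyclic_pred p j - wrap j"

definition cyclically_adjacent :: "nat \<Rightarrow> nat \<Rightarrow> nat \<Rightarrow> bool" where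
  "cyclically_adjacent p j k \<longleftrightarrow> cyclic_pred p j = k \<or> cyclic_pred p k = j"

lemma cyclically_adjacent_commute: "cyclically_adjacent p j k \<longleftrightarrow> cyclically_adjacent p k j"
  by (auto simp: cyclically_adjacent_def)

lemma cyclic_pred_less: "j < p \<Longrightarrow> cyclic_pred p j < p"
  by (auto simp: cyclic_pred_def)

lemma cyclic_pred_neq: "2 \<le> p \<Longrightarrow> cyclic_pred p j \<noteq> j"
  by (auto simp: cyclic_pred_def)

lemma cyclic_pred_pred_neq: "3 \<le> p \<Longrightarrow> cyclic_pred p (cyclic_pred p j) \<noteq> j"
  by (auto simp: cyclic_pred_def)

lemma cyclic_pred_eq_iff: "j < p \<Longrightarrow> k < p \<Longrightarrow> cyclic_pred p j = cyclic_pred p k \<longleftrightarrow> j = k"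
  by (auto simp: cyclic_pred_def)

lemma bij_betw_cyclic_pred: "bij_betw (cyclic_pred p) {..<p} {..<p}"
proof -
  have "inj_on (cyclic_pred p) {..<p}" by (auto simp: inj_on_def cyclic_pred_eq_iff)
  moreover from this have "cyclic_pred p ` {..<p} = {..<p}"
    by (intro endo_inj_surj) (auto simp: cyclic_pred_less)
  ultimately show ?thesis by (simp add: bij_betw_def)
qed

lemma allowed_iff_ascent: "allowed p w j c \<longleftrightarrow> int w \<le> ascent p c j"
  by (auto simp: allowed_def ascent_def cyclic_pred_def wrap_def)

lemma sum_ascent:
  assumes "0 < p"
  shows "(\<Sum>j<p. ascent p c j) = - 1"
proof -
  have "(\<Sum>j<p. c ! cyclic_pred p j) = (\<Sum>j<p. c ! j)"
    by (rule sum.reindex_bij_betw[OF bij_betw_cyclic_pred])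
  moreover have "(\<Sum>j<p. wrap j) = 1" using assms by (simp add: wrap_def)
  ultimately show ?thesis by (simp add: ascent_def sum_subtractf)
qed

lemma three_le_if_two_allowed:
  assumes "1 \<le> w" "j < p" "k < p" "j \<noteq> k" "allowed p w j c" "allowed p w k c"
  shows "3 \<le> p"
proof (rule ccontr)
  assume "\<not> 3 \<le> p"
  then have "{..<p} = {j, k}" using assms by auto
  then have "ascent p c j + ascent p c k = - 1" using sum_ascent[of p c] assms by simp
  then show False using assms by (simp add: allowed_iff_ascent)
qed

section \<open>Vectors with prescribed ascents\<close>

lemma nth_diff_eq_if_ascents_eq:
  assumes "\<And>j. j < p \<Longrightarrow> ascent p c j = ascent p d j" "j < p"
  shows "c ! j - d ! j = c ! 0 - d ! 0"
  using assms(2)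
proof (induction j)
  case (Suc j)
  then show ?case using assms(1)[of "Suc j"] by (simp add: ascent_def cyclic_pred_def)
qed simp

lemma eq_if_ascents_eq:
  assumes len: "length c = p" "length d = p"
    and sum: "sum_list c \<in> {0..<int p}" "sum_list d \<in> {0..<int p}"
    and ascents: "\<And>j. j < p \<Longrightarrow> ascent p c j = ascent p d j"
  shows "c = d"
proof -
  note diff = nth_diff_eq_if_ascents_eq[OF ascents]
  have "sum_list c - sum_list d = (\<Sum>j<p. c ! j - d ! j)"
    by (simp add: sum_list_sum_nth atLeast0LessThan len sum_subtractf)
  also have "\<dots> = (\<Sum>j<p. c ! 0 - d ! 0)" by (intro sum.cong refl diff) auto
  finally have sum_diff: "sum_list c - sum_list d = int p * (c ! 0 - d ! 0)" by simp
  then have "int p dvd sum_list c - sum_list d" by simp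
  then have "sum_list c = sum_list d"
    using sum by (metis mod_eq_dvd_iff mod_pos_pos_trivial atLeastLessThan_iff)
  then have "c ! 0 = d ! 0" using sum_diff sum by simp
  then show ?thesis using diff len by (intro nth_equalityI) auto
qed

lemma ex_vec_with_ascents:
  assumes sum_a: "(\<Sum>j<p. a j) = - 1"
  shows "\<exists>c. length c = p \<and> sum_list c \<in> {0..<int p} \<and> (\<forall>j<p. ascent p c j = a j)"
proof -
  have "0 < p" using sum_a by (cases p) auto
  define b where "b j = (\<Sum>i<j. a (Suc i))" for j
  define S where "S = (\<Sum>j<p. b j)"
  define c where "c = map (\<lambda>j. b j - S div int p) [0..<p]"
  have "sum_list c = S - int p * (S div int p)"
    by (simp add: sum_list_sum_nth atLeast0LessThan c_def S_def sum_subtractf)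
  then have "sum_list c = S mod int p" by (simp add: minus_mult_div_eq_mod)
  moreover have "a 0 + b (p - 1) = - 1"
    using sum_a \<open>0 < p\<close> sum.lessThan_Suc_shift[of a "p - 1"] by (simp add: b_def)
  then have "ascent p c j = a j" if "j < p" for j
    using that by (cases j) (auto simp: ascent_def c_def cyclic_pred_def wrap_def b_def)
  ultimately show ?thesis using \<open>0 < p\<close> by (intro exI[of _ c]) (simp add: c_def)
qed

section \<open>The Scopes moves\<close>

lemma length_sc: "length (sc p j c) = length c"
  by (simp add: sc_def)

context
  fixes p :: nat
  assumes two_le_p: "2 \<le> p"
begin

lemma nth_sc:
  assumes "length c = p" "j < p" "i < p"
  shows "sc p j c ! i =
    (if i = j then c ! cyclic_pred p j + wrap j
     else if i = cyclic_pred p j then c ! j - wrap j else c ! i)"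
  using assms two_le_p by (auto simp: sc_def cyclic_pred_def wrap_def nth_list_update)

lemmas nth_sc_simps = nth_sc length_sc cyclic_pred_less cyclic_pred_neq[OF two_le_p] cyclic_pred_eq_iff

lemma ascent_sc_self:
  assumes "length c = p" "j < p"
  shows "ascent p (sc p j c) j = - ascent p c j"
  using assms by (simp add: ascent_def nth_sc_simps)

lemma ascent_sc_distant:
  assumes "length c = p" "j < p" "k < p" "j \<noteq> k" "\<not> cyclically_adjacent p j k"
  shows "ascent p (sc p j c) k = ascent p c k"
  using assms by (auto simp: ascent_def cyclically_adjacent_def nth_sc_simps)

lemma ascent_sc_adjacent:
  assumes "3 \<le> p" "length c = p" "j < p" "k < p" "cyclically_adjacent p j k"
  shows "ascent p (sc p j c) k = ascent p c k + ascent p c j"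
  using assms cyclic_pred_pred_neq[OF assms(1)]
  by (auto simp: ascent_def cyclically_adjacent_def nth_sc_simps)

lemma sc_commute:
  assumes "length c = p" "j < p" "k < p" "j \<noteq> k" "\<not> cyclically_adjacent p j k"
  shows "sc p k (sc p j c) = sc p j (sc p k c)"
  by (rule nth_equalityI) (use assms in \<open>auto simp: cyclically_adjacent_def nth_sc_simps\<close>)

lemma sc_braid:
  assumes "3 \<le> p" "length c = p" "j < p" "k < p" "cyclically_adjacent p j k"
  shows "sc p j (sc p k (sc p j c)) = sc p k (sc p j (sc p k c))"
proof -
  have braid: "sc p a (sc p b (sc p a c)) = sc p b (sc p a (sc p b c))"
    if "a < p" "b < p" "cyclic_pred p b = a" for a b
    by (rule nth_equalityI)
      (use that assms(2) cyclic_pred_pred_neq[OF assms(1), of b] in \<open>auto simp: nth_sc_simps\<close>)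
  show ?thesis using assms braid[of j k] braid[of k j] by (auto simp: cyclically_adjacent_def)
qed

end

section \<open>Termination\<close>

definition potential :: "nat \<Rightarrow> int list \<Rightarrow> int" where
  "potential p c = (\<Sum>i<p. (int p * c ! i + int i)\<^sup>2)"

text \<open>In the coordinates \<open>x\<^sub>i = p c\<^sub>i + i\<close> every move replaces the pair \<open>x\<^sub>j, x\<^sub>i\<close>, where
  \<open>i\<close> precedes \<open>j\<close> cyclically, by \<open>x\<^sub>i + 1, x\<^sub>j - 1\<close>, and \<open>x\<^sub>j - x\<^sub>i - 1\<close> is \<open>p\<close> times the
  \<open>j\<close>-th ascent.\<close>

lemma potential_sc:
  assumes two_le_p: "2 \<le> p" and len: "length c = p" and j_less: "j < p"
  shows "potential p (sc p j c) = potential p c - 2 * int p * ascent p c j"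
proof -
  define i where "i = cyclic_pred p j"
  define x where "x d k = int p * d ! k + int k" for d k
  have i_less_neq: "i < p" "i \<noteq> j" using j_less by (auto simp: i_def nth_sc_simps[OF two_le_p])
  have split: "potential p d = (x d i)\<^sup>2 + ((x d j)\<^sup>2 + (\<Sum>k\<in>{..<p} - {i} - {j}. (x d k)\<^sup>2))" for d
    using i_less_neq j_less unfolding potential_def x_def
    by (subst sum.remove[of _ i], simp, simp) (subst sum.remove[of _ j], auto)
  have index_diff: "int j - int i = 1 - int p * wrap j"
    using j_less by (auto simp: i_def cyclic_pred_def wrap_def)
  have x_j: "x (sc p j c) j = x c i + 1"
    using index_diff by (simp add: x_def nth_sc[OF two_le_p] len j_less i_def algebra_simps)
  have x_i: "x (sc p j c) i = x c j - 1"
    using index_diff i_less_neq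
    by (simp add: x_def nth_sc[OF two_le_p] len j_less i_def[symmetric] algebra_simps)
  have rest: "(\<Sum>k\<in>{..<p} - {i} - {j}. (x (sc p j c) k)\<^sup>2) = (\<Sum>k\<in>{..<p} - {i} - {j}. (x c k)\<^sup>2)"
    by (rule sum.cong) (auto simp: x_def nth_sc[OF two_le_p] len j_less i_def)
  have x_diff: "x c j - x c i - 1 = int p * ascent p c j"
    using index_diff by (simp add: x_def ascent_def i_def algebra_simps)
  have "potential p (sc p j c) = potential p c - 2 * (x c j - x c i - 1)"
    by (simp only: split x_i x_j rest) (simp add: power2_eq_square algebra_simps)
  then show ?thesis by (simp only: x_diff mult.assoc)
qed

lemma wfp_scopes_step:
  assumes two_le_p: "2 \<le> p" and w_pos: "1 \<le> w"
  shows "wfp (scopes_step p w)\<inverse>\<inverse>"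
proof (rule wfp_if_convertible_to_nat)
  fix d c
  assume "(scopes_step p w)\<inverse>\<inverse> d c"
  then obtain j where step: "length c = p" "j < p" "int w \<le> ascent p c j" "d = sc p j c"
    by (auto simp: scopes_step_def cvecs_def allowed_iff_ascent)
  have "0 < int p * ascent p c j" using two_le_p w_pos step by (intro mult_pos_pos) auto
  then have "potential p d < potential p c" using potential_sc[OF two_le_p] step by simp
  moreover have "0 \<le> potential p d" unfolding potential_def by (rule sum_nonneg) simp
  ultimately show "nat (potential p d) < nat (potential p c)" by simp
qed

section \<open>Local confluence\<close>

lemma scopes_step_sc:
  "c \<in> cvecs p \<Longrightarrow> j < p \<Longrightarrow> int w \<le> ascent p c j \<Longrightarrow> scopes_step p w c (sc p j c)"
  by (auto simp: scopes_step_def allowed_iff_ascent)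

lemma scopes_step_distant:
  assumes two_le_p: "2 \<le> p" and c_mem: "c \<in> cvecs p" and j_less: "j < p" and k_less: "k < p"
    and distant: "j \<noteq> k" "\<not> cyclically_adjacent p j k"
    and w_le_k: "int w \<le> ascent p c k"
  shows "scopes_step p w (sc p j c) (sc p k (sc p j c))"
proof (rule scopes_step_sc)
  show "sc p j c \<in> cvecs p" using c_mem two_le_p j_less by (rule sc_in_cvecs)
  have "length c = p" using c_mem by (simp add: cvecs_def)
  then show "int w \<le> ascent p (sc p j c) k"
    using ascent_sc_distant[OF two_le_p] j_less k_less distant w_le_k by simp
qed (fact k_less)

lemma scopes_steps_adjacent:
  assumes three_le_p: "3 \<le> p" and c_mem: "c \<in> cvecs p" and j_less: "j < p" and k_less: "k < p"
    and adj: "cyclically_adjacent p j k"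
    and w_le_j: "int w \<le> ascent p c j" and w_le_k: "int w \<le> ascent p c k"
  shows "(scopes_step p w)\<^sup>*\<^sup>* (sc p j c) (sc p j (sc p k (sc p j c)))"
proof -
  let ?d = "sc p j c"
  have two_le_p: "2 \<le> p" using three_le_p by simp
  have mem: "?d \<in> cvecs p" "sc p k ?d \<in> cvecs p"
    using sc_in_cvecs c_mem j_less k_less two_le_p by blast+
  then have len: "length c = p" "length ?d = p" using c_mem by (auto simp: cvecs_def)
  have ascent_k: "ascent p ?d k = ascent p c k + ascent p c j"
    using ascent_sc_adjacent[OF two_le_p three_le_p] len j_less k_less adj by blast
  have "ascent p (sc p k ?d) j = ascent p ?d j + ascent p ?d k"
    using ascent_sc_adjacent[OF two_le_p three_le_p] len j_less k_less adj
      cyclically_adjacent_commute by blast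
  then have ascent_j: "ascent p (sc p k ?d) j = ascent p c k"
    using ascent_k ascent_sc_self[OF two_le_p] len j_less by simp
  have "scopes_step p w ?d (sc p k ?d)"
    using mem k_less w_le_j w_le_k ascent_k by (intro scopes_step_sc) auto
  moreover have "scopes_step p w (sc p k ?d) (sc p j (sc p k ?d))"
    using mem j_less w_le_k ascent_j by (intro scopes_step_sc) auto
  ultimately show ?thesis by (rule converse_rtranclp_into_rtranclp[OF _ r_into_rtranclp])
qed

lemma locally_confluentp_scopes_step:
  assumes two_le_p: "2 \<le> p" and w_pos: "1 \<le> w"
  shows "locally_confluentp (scopes_step p w)"
  unfolding locally_confluentp_def
proof (intro allI impI)
  fix c d e
  assume "scopes_step p w c d" "scopes_step p w c e"
  then obtain j k where c_mem: "c \<in> cvecs p"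
    and step_j: "j < p" "int w \<le> ascent p c j" "d = sc p j c"
    and step_k: "k < p" "int w \<le> ascent p c k" "e = sc p k c"
    by (auto simp: scopes_step_def allowed_iff_ascent)
  have len: "length c = p" using c_mem by (simp add: cvecs_def)
  consider (same) "j = k"
    | (distant) "j \<noteq> k" "\<not> cyclically_adjacent p j k"
    | (adjacent) "j \<noteq> k" "cyclically_adjacent p j k"
    by blast
  then show "\<exists>u. (scopes_step p w)\<^sup>*\<^sup>* d u \<and> (scopes_step p w)\<^sup>*\<^sup>* e u"
  proof cases
    case same
    then show ?thesis using step_j step_k by blast
  next
    case distant
    have "scopes_step p w d (sc p k d)" "scopes_step p w e (sc p j e)"
      using scopes_step_distant[OF two_le_p c_mem] distant step_j step_k cyclically_adjacent_commute
      by metis+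
    moreover have "sc p k d = sc p j e" using sc_commute[OF two_le_p] distant step_j step_k len by simp
    ultimately show ?thesis by (metis r_into_rtranclp)
  next
    case adjacent
    have "3 \<le> p"
      using three_le_if_two_allowed[OF w_pos step_j(1) step_k(1) adjacent(1)] step_j step_k
      by (simp add: allowed_iff_ascent)
    then show ?thesis
      using scopes_steps_adjacent[OF _ c_mem, of j k] scopes_steps_adjacent[OF _ c_mem, of k j]
        sc_braid[OF two_le_p _ len] cyclically_adjacent_commute step_j step_k adjacent
      by metis
  qed
qed

section \<open>Irreducible vectors\<close>

definition irreducible_vecs :: "nat \<Rightarrow> nat \<Rightarrow> int \<Rightarrow> int list set" where
  "irreducible_vecs p w s = {c. length c = p \<and> sum_list c = s \<and> (\<forall>j<p. \<not> allowed p w j c)}"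

lemma card_scopes_families_eq_irreducible:
  assumes two_le_p: "2 \<le> p" and w_pos: "1 \<le> w"
  shows "card (scopes_families p w) = card (irreducible_vecs p w 0)"
proof -
  let ?step = "scopes_step p w"
  have "confluentp ?step"
    by (intro newman wfp_scopes_step locally_confluentp_scopes_step two_le_p w_pos)
  moreover have "d \<in> cvecs p" if "c \<in> cvecs p" "?step c d" for c d
    using that two_le_p by (auto simp: scopes_step_def intro: sc_in_cvecs)
  ultimately have "bij_betw (\<lambda>c. scopes_equiv p w `` {c}) {c \<in> cvecs p. normal_form ?step c}
      (cvecs p // scopes_equiv p w)"
    by (intro bij_betw_normal_forms_quotient[where r = ?step] wfp_scopes_step
        two_le_p w_pos equiv_scopes_equiv)
      (auto simp: scopes_equiv_def)
  moreover have "{c \<in> cvecs p. normal_form ?step c} = irreducible_vecs p w 0"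
    by (auto simp: irreducible_vecs_def normal_form_def scopes_step_def cvecs_def)
  ultimately show ?thesis by (simp add: scopes_families_def bij_betw_same_card)
qed

definition cyclic_shift :: "int list \<Rightarrow> int list" where
  "cyclic_shift c = (last c + 1) # butlast c"

lemma nth_cyclic_shift:
  assumes "length c = p" "j < p"
  shows "cyclic_shift c ! j = c ! cyclic_pred p j + wrap j"
  using assms last_conv_nth[of c]
  by (cases j) (fastforce simp: cyclic_shift_def cyclic_pred_def wrap_def nth_butlast)+

lemma ascent_cyclic_shift:
  assumes "length c = p" "j < p"
  shows "ascent p (cyclic_shift c) j = ascent p c (cyclic_pred p j)"
  using assms by (simp add: ascent_def nth_cyclic_shift cyclic_pred_less)

lemma sum_list_cyclic_shift:
  assumes "c \<noteq> []"
  shows "sum_list (cyclic_shift c) = sum_list c + 1"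
proof -
  have "sum_list (cyclic_shift c) = sum_list (butlast c @ [last c]) + 1"
    unfolding cyclic_shift_def sum_list_append by simp
  then show ?thesis using assms by simp
qed

lemma cyclic_shift_mem_irreducible_vecs_iff:
  assumes "0 < p" "length c = p"
  shows "cyclic_shift c \<in> irreducible_vecs p w (s + 1) \<longleftrightarrow> c \<in> irreducible_vecs p w s"
proof -
  have "c \<noteq> []" using assms by auto
  have "(\<forall>j<p. \<not> allowed p w j (cyclic_shift c)) \<longleftrightarrow>
      (\<forall>j\<in>cyclic_pred p ` {..<p}. \<not> allowed p w j c)"
    using assms by (auto simp: allowed_iff_ascent ascent_cyclic_shift)
  also have "\<dots> \<longleftrightarrow> (\<forall>j<p. \<not> allowed p w j c)"
    using bij_betw_imp_surj_on[OF bij_betw_cyclic_pred, of p] by auto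
  finally show ?thesis
    using assms sum_list_cyclic_shift[OF \<open>c \<noteq> []\<close>]
    by (auto simp: irreducible_vecs_def cyclic_shift_def)
qed

lemma bij_betw_cyclic_shift:
  assumes p_pos: "0 < p"
  shows "bij_betw cyclic_shift (irreducible_vecs p w s) (irreducible_vecs p w (s + 1))"
proof (rule bij_betwI')
  fix c d
  assume "c \<in> irreducible_vecs p w s" "d \<in> irreducible_vecs p w s"
  then have "c \<noteq> []" "d \<noteq> []" using p_pos by (auto simp: irreducible_vecs_def)
  then show "cyclic_shift c = cyclic_shift d \<longleftrightarrow> c = d"
    by (auto simp: cyclic_shift_def) (metis append_butlast_last_id)
next
  fix c
  assume "c \<in> irreducible_vecs p w s"
  then show "cyclic_shift c \<in> irreducible_vecs p w (s + 1)"
    by (subst cyclic_shift_mem_irreducible_vecs_iff[OF p_pos]) (simp_all add: irreducible_vecs_def)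
next
  fix d
  assume d_irreducible: "d \<in> irreducible_vecs p w (s + 1)"
  then have len: "length d = p" by (simp add: irreducible_vecs_def)
  then obtain x xs where "d = x # xs" using p_pos by (cases d) auto
  then have "length (xs @ [x - 1]) = p" "d = cyclic_shift (xs @ [x - 1])"
    using len by (simp_all add: cyclic_shift_def)
  then show "\<exists>c\<in>irreducible_vecs p w s. d = cyclic_shift c"
    using d_irreducible cyclic_shift_mem_irreducible_vecs_iff[OF p_pos] by metis
qed

lemma card_irreducible_vecs_sum_independent:
  assumes p_pos: "0 < p"
  shows "card (irreducible_vecs p w s) = card (irreducible_vecs p w t)"
proof (induction s rule: int_induct[where k = t])
  case (step1 s)
  then show ?case using bij_betw_same_card[OF bij_betw_cyclic_shift[OF p_pos], of w s] by simp
next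
  case (step2 s)
  then show ?case using bij_betw_same_card[OF bij_betw_cyclic_shift[OF p_pos], of w "s - 1"] by simp
qed simp

section \<open>Counting irreducible vectors\<close>

definition slack :: "nat \<Rightarrow> nat \<Rightarrow> int list \<Rightarrow> nat list" where
  "slack p w c = map (\<lambda>j. nat (int w - 1 - ascent p c j)) [0..<p]"

lemma nth_slack:
  assumes "c \<in> irreducible_vecs p w s" "j < p"
  shows "int (slack p w c ! j) = int w - 1 - ascent p c j"
  using assms by (auto simp: slack_def irreducible_vecs_def allowed_iff_ascent)

lemma sum_list_slack:
  assumes p_pos: "0 < p" and w_pos: "1 \<le> w" and c_irreducible: "c \<in> irreducible_vecs p w s"
  shows "sum_list (slack p w c) = p * (w - 1) + 1"
proof -
  have "int (sum_list (slack p w c)) = (\<Sum>j<p. int (slack p w c ! j))"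
    by (simp add: sum_list_sum_nth atLeast0LessThan slack_def)
  also have "\<dots> = (\<Sum>j<p. int w - 1 - ascent p c j)" by (simp add: nth_slack[OF c_irreducible])
  also have "\<dots> = int p * (int w - 1) + 1" using sum_ascent p_pos by (simp add: sum_subtractf)
  also have "\<dots> = int (p * (w - 1) + 1)" using w_pos by (simp add: of_nat_diff)
  finally show ?thesis by (simp only: of_nat_eq_iff)
qed

lemma slack_eq_iff:
  assumes c_irreducible: "c \<in> irreducible_vecs p w s" "s \<in> {0..<int p}"
    and d_irreducible: "d \<in> irreducible_vecs p w t" "t \<in> {0..<int p}"
  shows "slack p w c = slack p w d \<longleftrightarrow> c = d"
proof
  assume slack_eq: "slack p w c = slack p w d"
  show "c = d"
  proof (rule eq_if_ascents_eq)
    show "ascent p c j = ascent p d j" if "j < p" for j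
      using nth_slack[OF c_irreducible(1) that] nth_slack[OF d_irreducible(1) that] slack_eq by simp
  qed (use assms in \<open>auto simp: irreducible_vecs_def\<close>)
qed simp

lemma ex_irreducible_vec_with_slack:
  assumes w_pos: "1 \<le> w" and len: "length e = p" and sum: "sum_list e = p * (w - 1) + 1"
  shows "\<exists>s\<in>{0..<int p}. \<exists>c\<in>irreducible_vecs p w s. e = slack p w c"
proof -
  have "(\<Sum>j<p. int (e ! j)) = int (sum_list e)"
    by (simp add: sum_list_sum_nth atLeast0LessThan len)
  also have "\<dots> = int p * (int w - 1) + 1" using sum w_pos by (simp add: of_nat_diff)
  finally have "(\<Sum>j<p. int w - 1 - int (e ! j)) = - 1" by (simp add: sum_subtractf)
  from ex_vec_with_ascents[OF this]
  obtain c where c_window: "length c = p" "sum_list c \<in> {0..<int p}"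
    and ascent: "\<And>j. j < p \<Longrightarrow> ascent p c j = int w - 1 - int (e ! j)"
    by blast
  have "e = slack p w c"
    by (rule nth_equalityI) (auto simp: slack_def len ascent)
  moreover have "c \<in> irreducible_vecs p w (sum_list c)"
    using c_window ascent by (auto simp: irreducible_vecs_def allowed_iff_ascent)
  ultimately show ?thesis using c_window(2) by blast
qed

lemma bij_betw_slack:
  assumes p_pos: "0 < p" and w_pos: "1 \<le> w"
  shows "bij_betw (slack p w) (\<Union>s\<in>{0..<int p}. irreducible_vecs p w s)
           {e. length e = p \<and> sum_list e = p * (w - 1) + 1}"
proof (rule bij_betwI')
  fix c d
  assume "c \<in> (\<Union>s\<in>{0..<int p}. irreducible_vecs p w s)"
    and "d \<in> (\<Union>s\<in>{0..<int p}. irreducible_vecs p w s)"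
  then show "slack p w c = slack p w d \<longleftrightarrow> c = d" using slack_eq_iff by blast
next
  fix c
  assume "c \<in> (\<Union>s\<in>{0..<int p}. irreducible_vecs p w s)"
  then show "slack p w c \<in> {e. length e = p \<and> sum_list e = p * (w - 1) + 1}"
    using sum_list_slack[OF p_pos w_pos] by (auto simp: slack_def)
next
  fix e
  assume "e \<in> {e. length e = p \<and> sum_list e = p * (w - 1) + 1}"
  then show "\<exists>c\<in>\<Union>s\<in>{0..<int p}. irreducible_vecs p w s. e = slack p w c"
    using ex_irreducible_vec_with_slack[OF w_pos, of e p] by auto
qed

lemma card_slacks:
  assumes p_pos: "0 < p" and w_pos: "1 \<le> w"
  shows "card {e :: nat list. length e = p \<and> sum_list e = p * (w - 1) + 1} = p * w choose (p - 1)"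
proof -
  have total: "p * (w - 1) + p = p * w" using w_pos by (cases w) auto
  have "card {e :: nat list. length e = p \<and> sum_list e = p * (w - 1) + 1} =
      (p * (w - 1) + 1 + p - 1) choose (p * (w - 1) + 1)"
    by (rule card_length_sum_list)
  also have "\<dots> = p * w choose (p * w - (p - 1))"
    using total p_pos by (intro arg_cong2[where f = binomial]) auto
  also have "\<dots> = p * w choose (p - 1)"
    using total p_pos by (intro binomial_symmetric[symmetric]) linarith
  finally show ?thesis .
qed

lemma card_irreducible_vecs:
  assumes p_pos: "0 < p" and w_pos: "1 \<le> w"
  shows "p * card (irreducible_vecs p w s) = p * w choose (p - 1)"
proof -
  let ?U = "\<Union>t\<in>{0..<int p}. irreducible_vecs p w t"
  have card_U: "card ?U = p * w choose (p - 1)"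
    using bij_betw_same_card[OF bij_betw_slack[OF p_pos w_pos]] card_slacks[OF p_pos w_pos] by simp
  have "p \<le> p * w" using w_pos by simp
  then have "p - 1 \<le> p * w" by linarith
  then have "card ?U > 0" by (simp add: card_U)
  then have "finite ?U" by (rule card_ge_0_finite)
  then have "card ?U = (\<Sum>t\<in>{0..<int p}. card (irreducible_vecs p w t))"
    by (intro card_UN_disjoint) (auto simp: irreducible_vecs_def)
  also have "\<dots> = (\<Sum>t\<in>{0..<int p}. card (irreducible_vecs p w s))"
    by (intro sum.cong refl card_irreducible_vecs_sum_independent p_pos)
  finally show ?thesis using card_U by simp
qed

theorem card_scopes_families:
  assumes "2 \<le> p" "1 \<le> w"
  shows "p * card (scopes_families p w) = p * w choose (p - 1)"
  using card_irreducible_vecs assms by (simp add: card_scopes_families_eq_irreducible)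

theorem theorem4p12:
  fixes p w :: nat
  assumes "prime p" and "w \<ge> 1"
  shows "real (card (scopes_families p w)) = 1 / real p * real ((p * w) choose (p - 1))"
proof -
  have "2 \<le> p" using assms(1) by (rule prime_ge_2_nat)
  then have "real p * real (card (scopes_families p w)) = real (p * w choose (p - 1))"
    using card_scopes_families assms(2) by (metis of_nat_mult)
  then show ?thesis using \<open>2 \<le> p\<close> by (simp add: field_simps)
qed

end
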